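(* Let $t>0$, and for each integer $k\ge 0$ let $Y(z;k)$ be the unique $2\times 2$ matrix-valued solution of the following Riemann-Hilbert problem on the unit circle $\Sigma=\{|z|=1\}$, oriented counterclockwise: (i) $Y(\cdot;k)$ is analytic in $\{|z|<1\}$ and in $\{|z|>1\}$, and extends continuously to $\Sigma$ from each side; (ii) $Y_+(z;k)=Y_-(z;k)\begin{pmatrix}1 & z^{-k}e^{t(z+z^{-1})}\\ 0&1\end{pmatrix}$ for $z\in\Sigma$, where $Y_+$ (resp. $Y_-$) is the limit from inside (resp. outside) $\Sigma$; (iii) $Y(z;k)=(I+O(z^{-1}))\begin{pmatrix} z^k&0\\0&z^{-k}\end{pmatrix}$ as $z\to\infty$. Write $$Y(0;k)=\begin{pmatrix}-b(k) & d(k)\\ -a(k) & -b(k)\end{pmatrix}.$$ Then for every integer $k\ge 1$, $b$ satisfies the discrete Painlevé II equation $$\frac{k}{t}\,b(k)+\bigl(b(k-1)+b(k+1)\bigr)\bigl(1-b(k)^2\bigr)=0,$$ and $a$ and $d$ satisfy $$a(k)=\bigl(1-b(k)^2\bigr)\,a(k+1),\qquad d(k)=\bigl(1-b(k)^2\bigr)\,d(k-1).$$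
   Context: The Riemann-Hilbert problem has a unique solution for each integer $k\ge 0$. Let $\varphi(z)=e^{t(z+z^{-1})}$, and let $\pi_k$ be the monic orthogonal polynomial of degree $k$ for the measure $\varphi(z)\frac{dz}{2\pi i z}$ on $\Sigma$, that is, $\int_{|z|=1}\pi_k(z)\overline{z^j}\varphi(z)\frac{dz}{2\pi i z}=N_k\delta_{jk}$ for $0\le j\le k$. Let $\pi_n^*(z)=z^n\pi_n(1/z)$. Then for $k\ge1$ the first column of the solution is $Y_{11}(z;k)=\pi_k(z)$, $Y_{21}(z;k)=-N_{k-1}^{-1}\pi_{k-1}^*(z)$, and the second column is obtained from the first by $Y_{j2}(z;k)=\frac{1}{2\pi i}\int_\Sigma \frac{Y_{j1}(s;k)\,s^{-k}\varphi(s)}{s-z}\,ds$, $j=1,2$. For $k=0$ the first column is $(1,0)^T$, and the second column is $\left(\frac{1}{2\pi i}\int_\Sigma\frac{\varphi(s)}{s-z}ds,\;1\right)^T$. The two diagonal entries of $Y(0;k)$ are equal, so the displayed form of $Y(0;k)$ defines $a(k),b(k),d(k)$ consistently. *)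

theory Defs
  imports "HOL-Complex_Analysis.Complex_Analysis" "HOL-Library.Landau_Symbols"
begin

abbreviation mat2 :: "complex \<Rightarrow> complex \<Rightarrow> complex \<Rightarrow> complex \<Rightarrow> complex^2^2" where
  "mat2 p q r s \<equiv> vector [vector [p, q], vector [r, s]]"

definition jump :: "real \<Rightarrow> nat \<Rightarrow> complex \<Rightarrow> complex^2^2" where
  "jump t k z = mat2 1 (z powi (- int k) * exp (of_real t * (z + inverse z))) 0 1"

text \<open>
  Analyticity and the error term are understood entrywise.
  \<open>Yp\<close> and \<open>Ym\<close> are the continuous extensions of \<open>Y\<close> to the unit circle from the inside and
  from the outside; the values of \<open>Y\<close> itself on the circle are irrelevant.
\<close>

definition solves_RHP :: "real \<Rightarrow> nat \<Rightarrow> (complex \<Rightarrow> complex^2^2) \<Rightarrow> bool" where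
  "solves_RHP t k Y \<longleftrightarrow>
     (\<forall>i j. (\<lambda>z. Y z $ i $ j) holomorphic_on {z. norm z < 1}) \<and>
     (\<forall>i j. (\<lambda>z. Y z $ i $ j) holomorphic_on {z. norm z > 1}) \<and>
     (\<exists>Yp Ym.
        continuous_on {z. norm z \<le> 1} Yp \<and> (\<forall>z. norm z < 1 \<longrightarrow> Yp z = Y z) \<and>
        continuous_on {z. norm z \<ge> 1} Ym \<and> (\<forall>z. norm z > 1 \<longrightarrow> Ym z = Y z) \<and>
        (\<forall>z. norm z = 1 \<longrightarrow> Yp z = Ym z ** jump t k z)) \<and>
     (\<exists>E. (\<forall>i j. (\<lambda>z. E z $ i $ j) \<in> O[at_infinity](\<lambda>z. inverse z)) \<and>
        (\<forall>\<^sub>F z in at_infinity. Y z = (mat 1 + E z) ** mat2 (z ^ k) 0 0 (z powi (- int k))))"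

end

theory Submission
  imports Defs
begin

text \<open>
  The first column of \<open>Y(\<cdot>; k)\<close> does not jump, so it is a polynomial: \<open>Y\<^sub>1\<^sub>1\<close> is monic of degree \<open>k\<close>
  and \<open>Y\<^sub>2\<^sub>1\<close> has degree less than \<open>k\<close>. Integrating the jump of the second column against powers of \<open>z\<close>
  over the circle gives moment conditions on these polynomials, in which \<open>d k\<close> is the norm \<open>N\<^sub>k\<close>.
  The moment conditions on \<open>q = Y\<^sub>2\<^sub>1(\<cdot>; k)\<close> say that pairing \<open>r\<close>, of degree at most \<open>k\<close> with leading
  coefficient \<open>r\<^sub>k\<close>, against \<open>q\<close> yields \<open>- r(0) - b(k) r\<^sub>k\<close>, while orthogonality leaves
  only one or two terms of the same pairing when \<open>r\<close> is one of \<open>\<pi>\<^sub>k\<^sub>-\<^sub>1\<close>, \<open>\<pi>\<^sub>k\<^sub>-\<^sub>1\<^sup>*\<close>, \<open>z \<pi>\<^sub>k\<^sub>-\<^sub>1\<close>, \<open>\<pi>\<^sub>k\<^sup>*\<close>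
  and \<open>z \<pi>\<^sub>k' - k \<pi>\<^sub>k\<close>. Comparing the two values in these five cases gives all the identities;
  uniqueness of orthogonal polynomials is not needed.
\<close>

section \<open>Means over the unit circle and Cauchy's formula\<close>

text \<open>The contour integral of f(z) dz / (2 pi i z), encoded as a real integral so that
  linearity and the substitution z -> 1/z come from the interval.\<close>

definition circle_mean :: "(complex \<Rightarrow> complex) \<Rightarrow> complex" where
  "circle_mean f = integral {0..1} (\<lambda>x. f (cis (2 * pi * x)))"

lemma circle_mean_cong:
  assumes "\<And>z. norm z = 1 \<Longrightarrow> f z = g z"
  shows "circle_mean f = circle_mean g"
  unfolding circle_mean_def using assms by (intro integral_cong) simp

lemma integrable_on_circle:
  fixes f :: "complex \<Rightarrow> complex"
  assumes "continuous_on (sphere 0 1) f"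
  shows "(\<lambda>x. f (cis (2 * pi * x))) integrable_on {0..1}"
proof (rule integrable_continuous_interval)
  have "continuous_on {0..1} (\<lambda>x. cis (2 * pi * x))"
    unfolding cis_conv_exp by (intro continuous_intros)
  then show "continuous_on {0..1} (\<lambda>x. f (cis (2 * pi * x)))"
    by (rule continuous_on_compose2[OF assms]) auto
qed

lemma circle_mean_add:
  assumes "continuous_on (sphere 0 1) f" "continuous_on (sphere 0 1) g"
  shows "circle_mean (\<lambda>z. f z + g z) = circle_mean f + circle_mean g"
  unfolding circle_mean_def by (intro integral_add integrable_on_circle assms)

lemma circle_mean_sum:
  assumes "finite A" "\<And>i. i \<in> A \<Longrightarrow> continuous_on (sphere 0 1) (f i)"
  shows "circle_mean (\<lambda>z. \<Sum>i\<in>A. f i z) = (\<Sum>i\<in>A. circle_mean (f i))"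
  unfolding circle_mean_def using assms by (intro integral_sum integrable_on_circle) auto

lemma circle_mean_mult_left: "circle_mean (\<lambda>z. c * f z) = c * circle_mean f"
  unfolding circle_mean_def by simp

lemma circle_mean_inverse: "circle_mean (\<lambda>z. f (inverse z)) = circle_mean f"
proof -
  define h where "h = (\<lambda>x. f (cis (2 * pi * x)))"
  have "inverse (cis (2 * pi * x)) = cis (2 * pi * (1 - x))" for x
  proof -
    have "2 * pi * (1 - x) = 2 * pi - 2 * pi * x"
      by (simp add: algebra_simps)
    then show ?thesis
      by (simp only:) (simp add: complex_eq_iff)
  qed
  then have "circle_mean (\<lambda>z. f (inverse z)) = integral {0..1} (\<lambda>x. h (- (x + (-1))))"
    by (simp add: circle_mean_def h_def)
  also have "\<dots> = integral {-1..0} (\<lambda>x. h (- x))"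
    using integral_shift_real_ivl[of "-1" "-1" 0 "\<lambda>x. h (- x)"] by simp
  also have "\<dots> = integral {0..1} h"
    using Henstock_Kurzweil_Integration.integral_reflect_real[of 1 0 h] by simp
  finally show ?thesis
    by (simp add: h_def circle_mean_def)
qed

lemma circle_mean_eqI:
  assumes "((\<lambda>z. f z / z) has_contour_integral 2 * of_real pi * \<i> * J) (circlepath 0 1)"
  shows "circle_mean f = J"
proof -
  have path: "circlepath 0 1 x = cis (2 * pi * x)" for x
    by (simp add: circlepath cis_conv_exp mult_ac)
  have "((\<lambda>x. f (circlepath 0 1 x) / circlepath 0 1 x *
          vector_derivative (circlepath 0 1) (at x within {0..1})) has_integral 2 * of_real pi * \<i> * J) {0..1}"
    using assms by (simp add: has_contour_integral_def)
  then have "((\<lambda>x. 2 * of_real pi * \<i> * f (cis (2 * pi * x))) has_integral 2 * of_real pi * \<i> * J) {0..1}"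
    by (rule has_integral_eq[rotated])
      (simp add: vector_derivative_circlepath01 path, simp add: cis_conv_exp mult_ac)
  from has_integral_mult_right[OF this, of "inverse (2 * of_real pi * \<i>)"]
  have "((\<lambda>x. f (cis (2 * pi * x))) has_integral J) {0..1}"
    by (simp add: field_simps)
  then show ?thesis
    unfolding circle_mean_def by (rule integral_unique)
qed

text \<open>Cauchy's formula in the form that asks only for continuity up to the circle, which is
  all that the boundary values of \<open>Y\<close> offer.\<close>

lemma circle_mean_interior_coeff:
  assumes "continuous_on (cball 0 1) f" "f holomorphic_on ball 0 1"
  shows "circle_mean (\<lambda>z. f z * z powi (- int n)) = (deriv ^^ n) f 0 / fact n"
proof (rule circle_mean_eqI)
  have "((\<lambda>u. f u / (u - 0) ^ Suc n) has_contour_integral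
      2 * of_real pi * \<i> / fact n * (deriv ^^ n) f 0) (circlepath 0 1)"
    using Cauchy_has_contour_integral_higher_derivative_circlepath[OF assms, of 0 n] by simp
  moreover have "f z * z powi (- int n) / z = f z / (z - 0) ^ Suc n" for z
    by (simp add: power_int_minus divide_inverse)
  ultimately show "((\<lambda>z. f z * z powi (- int n) / z) has_contour_integral
      2 * of_real pi * \<i> * ((deriv ^^ n) f 0 / fact n)) (circlepath 0 1)"
    by simp
qed

lemma circle_mean_interior:
  assumes "continuous_on (cball 0 1) f" "f holomorphic_on ball 0 1"
  shows "circle_mean f = f 0"
  using circle_mean_interior_coeff[OF assms, of 0] by simp

text \<open>Inversion carries the exterior to the punctured disc, where the limit at infinity fills
  the removable singularity at 0; then the mean value property applies.\<close>

lemma circle_mean_exterior: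
  assumes cont: "continuous_on {z. norm z \<ge> 1} f"
    and holo: "f holomorphic_on {z. norm z > 1}"
    and lim: "(f \<longlongrightarrow> l) at_infinity"
  shows "circle_mean f = l"
proof -
  define g where "g = (\<lambda>w. if w = 0 then l else f (inverse w))"
  have inv: "norm (inverse w) \<ge> 1" if "w \<in> cball 0 1 - {0}" for w :: complex
    using that by (simp add: norm_inverse one_le_inverse_iff)
  have inv': "norm (inverse w) > 1" if "w \<in> ball 0 1 - {0}" for w :: complex
    using that by (simp add: norm_inverse one_less_inverse_iff)
  have cont0: "continuous_on (cball 0 1 - {0}) g"
  proof -
    have "continuous_on (cball 0 1 - {0}) (\<lambda>w. f (inverse w))"
      by (rule continuous_on_compose2[OF cont]) (use inv in \<open>auto intro!: continuous_intros\<close>)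
    then show ?thesis
      by (rule continuous_on_cong[THEN iffD1, rotated 2]) (auto simp: g_def)
  qed
  have contg: "continuous_on (cball 0 1) g"
    unfolding continuous_on_eq_continuous_within
  proof
    fix w :: complex assume w: "w \<in> cball 0 1"
    show "continuous (at w within cball 0 1) g"
    proof (cases "w = 0")
      case True
      have "((f \<circ> inverse) \<longlongrightarrow> l) (at 0)"
        using lim by (simp add: lim_at_infinity_0)
      then have "(g \<longlongrightarrow> l) (at 0)"
        by (rule Lim_transform_eventually) (auto simp: eventually_at_filter g_def)
      then have "isCont g 0"
        by (simp add: isCont_def g_def)
      then show ?thesis
        using True continuous_at_imp_continuous_at_within by blast
    next
      case False
      have "continuous (at w within cball 0 1 - {0}) g"
        using cont0 False w by (simp add: continuous_on_eq_continuous_within)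
      moreover have "at w within cball 0 1 - {0} = at w within cball 0 1"
        by (rule at_within_nhd[of _ "- {0}"]) (use False in auto)
      ultimately show ?thesis by simp
    qed
  qed
  have "(f \<circ> inverse) holomorphic_on (ball 0 1 - {0})"
    by (rule holomorphic_on_compose_gen[OF _ holo]) (use inv' in \<open>auto intro!: holomorphic_intros\<close>)
  then have "g holomorphic_on (ball 0 1 - {0})"
    by (rule holomorphic_transform) (auto simp: g_def)
  then have "g holomorphic_on ball 0 1"
    by (rule no_isolated_singularity[rotated])
      (use continuous_on_subset[OF contg ball_subset_cball] in auto)
  then have "circle_mean g = l"
    using circle_mean_interior[OF contg] by (simp add: g_def)
  moreover have "circle_mean g = circle_mean (\<lambda>w. f (inverse w))"
    by (rule circle_mean_cong) (auto simp: g_def)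
  ultimately show ?thesis
    by (simp add: circle_mean_inverse)
qed

text \<open>Liouville's argument on Taylor coefficients: the n-th coefficient of \<open>p\<close> is
  a circle mean that can also be computed outside with \<open>m\<close>. For n = k it is
  \<open>l\<close>, for n > k it is 0, so the series stops.\<close>

lemma polynomial_of_glued:
  assumes contp: "continuous_on (cball 0 1) p" and holp: "p holomorphic_on ball 0 1"
    and contm: "continuous_on {z. norm z \<ge> 1} m" and holm: "m holomorphic_on {z. norm z > 1}"
    and glue: "\<And>z. norm z = 1 \<Longrightarrow> p z = m z"
    and lim: "((\<lambda>z. m z * z powi (- int k)) \<longlongrightarrow> l) at_infinity"
  obtains P where "P k = l" "P 0 = p 0" "\<And>z. norm z = 1 \<Longrightarrow> p z = (\<Sum>i\<le>k. P i * z ^ i)"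
proof -
  define P where "P = (\<lambda>n. (deriv ^^ n) p 0 / fact n)"
  have P: "P n = (if n = k then l else 0)" if "n \<ge> k" for n
  proof -
    define r where "r = n - k"
    have n: "n = k + r" using that by (simp add: r_def)
    have "((\<lambda>z. inverse z ^ r) \<longlongrightarrow> (0::complex) ^ r) at_infinity"
      by (intro tendsto_power tendsto_inverse_0)
    from tendsto_mult[OF lim this]
    have *: "((\<lambda>z. m z * z powi (- int k) * inverse z ^ r) \<longlongrightarrow> (if n = k then l else 0)) at_infinity"
      by (cases "r = 0") (simp_all add: n zero_power)
    have "((\<lambda>z. m z * z powi (- int n)) \<longlongrightarrow> (if n = k then l else 0)) at_infinity"
    proof -
      \<comment> \<open>In powers of \<open>inverse z\<close> the identity below holds at z = 0 too,
        so no side condition arises.\<close>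
      have "z powi (- int i) = inverse z ^ i" for z :: complex and i
        by (simp add: power_int_minus power_inverse)
      then have "m z * z powi (- int k) * inverse z ^ r = m z * z powi (- int n)" for z
        by (simp only: n power_add mult.assoc)
      then show ?thesis using * by (simp only:)
    qed
    moreover have "continuous_on {z. norm z \<ge> 1} (\<lambda>z. m z * z powi (- int n))"
      by (intro continuous_intros contm) auto
    moreover have "(\<lambda>z. m z * z powi (- int n)) holomorphic_on {z. norm z > 1}"
      by (intro holomorphic_intros holm) auto
    ultimately have "circle_mean (\<lambda>z. m z * z powi (- int n)) = (if n = k then l else 0)"
      by (intro circle_mean_exterior)
    moreover have "circle_mean (\<lambda>z. p z * z powi (- int n)) = circle_mean (\<lambda>z. m z * z powi (- int n))"
      by (rule circle_mean_cong) (simp add: glue)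
    ultimately show ?thesis
      using circle_mean_interior_coeff[OF contp holp, of n] by (simp add: P_def)
  qed
  have in_ball: "p z = (\<Sum>i\<le>k. P i * z ^ i)" if "z \<in> ball 0 1" for z
  proof -
    have "(\<lambda>n. P n * z ^ n) sums p z"
      using holomorphic_power_series[OF holp that] by (simp add: P_def)
    moreover have "(\<lambda>n. P n * z ^ n) sums (\<Sum>i\<le>k. P i * z ^ i)"
      by (rule sums_finite) (auto simp: P)
    ultimately show ?thesis by (rule sums_unique2)
  qed
  \<comment> \<open>The power series gives the identity in the open disc only; continuity carries it
    to the circle.\<close>
  have "p z - (\<Sum>i\<le>k. P i * z ^ i) = 0" if "norm z = 1" for z
  proof (rule continuous_constant_on_closure[of "ball 0 1" "\<lambda>z. p z - (\<Sum>i\<le>k. P i * z ^ i)"])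
    show "continuous_on (closure (ball 0 1)) (\<lambda>z. p z - (\<Sum>i\<le>k. P i * z ^ i))"
      using contp by (auto intro!: continuous_intros)
  qed (use that in_ball in auto)
  then show thesis
    using P[of k] by (intro that[of P]) (auto simp: P_def)
qed

section \<open>The weight, its moments, and the jump of a single row\<close>

definition weight :: "real \<Rightarrow> complex \<Rightarrow> complex" where
  "weight t z = exp (of_real t * (z + inverse z))"

text \<open>These are the modified Bessel functions I_n(2t).\<close>

definition moment :: "real \<Rightarrow> int \<Rightarrow> complex" where
  "moment t n = circle_mean (\<lambda>z. z powi n * weight t z)"

lemma continuous_on_weight [continuous_intros]: "0 \<notin> S \<Longrightarrow> continuous_on S (weight t)"
  unfolding weight_def by (intro continuous_intros) auto

lemma moment_minus: "moment t (- n) = moment t n"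
proof -
  have "circle_mean (\<lambda>z. inverse z powi n * weight t (inverse z)) = moment t n"
    using circle_mean_inverse[of "\<lambda>z. z powi n * weight t z"] by (simp add: moment_def)
  then show ?thesis
    by (simp add: moment_def weight_def power_int_minus power_int_inverse add.commute)
qed

text \<open>Integration by parts: the derivative of z^n times the weight integrates to 0 over the
  closed circle.\<close>

lemma moment_recurrence:
  "of_int n * moment t n = of_real t * (moment t (n - 1) - moment t (n + 1))"
proof -
  define F where "F = (\<lambda>z. z powi n * weight t z)"
  \<comment> \<open>\<open>f\<close> is z F'(z), so \<open>f z / z\<close> has the primitive
    \<open>F\<close> away from 0.\<close>
  define f where "f = (\<lambda>z. of_int n * (z powi n * weight t z) + of_real t * (z powi (n + 1) * weight t z)
    + (- of_real t) * (z powi (n - 1) * weight t z))"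
  have "(F has_field_derivative f z / z) (at z within - {0})" if "z \<in> - {0}" for z
  proof -
    have z: "z \<noteq> 0" using that by simp
    have "(weight t has_field_derivative weight t z * (of_real t * (1 - inverse z * inverse z))) (at z within - {0})"
      unfolding weight_def using z by (auto intro!: derivative_eq_intros simp: power2_eq_square)
    moreover have "((\<lambda>z. z powi n) has_field_derivative of_int n * z powi (n - 1)) (at z within - {0})"
      unfolding has_field_derivative_def
      by (rule has_derivative_eq_rhs[OF has_derivative_power_int'[OF z]]) (auto simp: fun_eq_iff)
    ultimately have "(F has_field_derivative of_int n * z powi (n - 1) * weight t z +
        weight t z * (of_real t * (1 - inverse z * inverse z)) * z powi n) (at z within - {0})"
      unfolding F_def by (rule DERIV_mult[rotated])
    moreover have "of_int n * z powi (n - 1) * weight t z +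
        weight t z * (of_real t * (1 - inverse z * inverse z)) * z powi n = f z / z"
      unfolding f_def using z by (simp add: power_int_add power_int_diff field_simps)
    ultimately show ?thesis by simp
  qed
  then have "((\<lambda>z. f z / z) has_contour_integral 0) (circlepath 0 1)"
    by (rule Cauchy_theorem_primitive) auto
  then have "circle_mean f = 0"
    by (intro circle_mean_eqI) simp
  moreover have "circle_mean f = of_int n * moment t n + of_real t * moment t (n + 1) + (- of_real t) * moment t (n - 1)"
  proof -
    have cont: "continuous_on (sphere 0 1) (\<lambda>z. c * (z powi m * weight t z))" for c m
      by (intro continuous_intros) auto
    show ?thesis
      unfolding f_def moment_def
      by (simp only: circle_mean_add cont continuous_on_add circle_mean_mult_left)
  qed
  ultimately show ?thesis by (simp add: algebra_simps)
qed

text \<open>The jump of the second column is multiplied by z^(k-j) and averaged. The inner side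
  gives a value at 0, the outer side a limit at infinity, and the remaining term expands into
  moments.\<close>

lemma jump_row_moments:
  assumes contup: "continuous_on (cball 0 1) up" and holup: "up holomorphic_on ball 0 1"
    and contum: "continuous_on {z. norm z \<ge> 1} um" and holum: "um holomorphic_on {z. norm z > 1}"
    and contvp: "continuous_on (cball 0 1) vp" and holvp: "vp holomorphic_on ball 0 1"
    and contvm: "continuous_on {z. norm z \<ge> 1} vm" and holvm: "vm holomorphic_on {z. norm z > 1}"
    and jump1: "\<And>z. norm z = 1 \<Longrightarrow> up z = um z"
    and jump2: "\<And>z. norm z = 1 \<Longrightarrow> vp z = um z * (z powi (- int k) * weight t z) + vm z"
    and lim1: "((\<lambda>z. um z * z powi (- int k)) \<longlongrightarrow> l) at_infinity"
    and lim2: "((\<lambda>z. vm z * z powi (int k)) \<longlongrightarrow> l') at_infinity"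
  obtains P where "P k = l" "P 0 = up 0"
    "\<And>j. j \<le> k \<Longrightarrow> (\<Sum>i\<le>k. P i * moment t (int i - int j)) =
       (if j = k then vp 0 else 0) - (if j = 0 then l' else 0)"
proof -
  obtain P where P: "P k = l" "P 0 = up 0" "\<And>z. norm z = 1 \<Longrightarrow> up z = (\<Sum>i\<le>k. P i * z ^ i)"
    using polynomial_of_glued[OF contup holup contum holum jump1 lim1] by blast
  show thesis
  proof (rule that[OF P(1,2)])
    fix j assume j: "j \<le> k"
    \<comment> \<open>The factor z^n turns z^(-k) into z^(-j). The inner mean survives only for n =
      0, that is j = k, and the outer one only for n = k, that is j = 0.\<close>
    define n where "n = k - j"
    have contm: "continuous_on (sphere 0 1) (\<lambda>z. vm z * z ^ n)"
      by (intro continuous_intros continuous_on_subset[OF contvm]) auto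
    have jk: "int j = int k - int n" "n \<le> k" using j by (auto simp: n_def)
    have "circle_mean (\<lambda>z. vp z * z ^ n) = vp 0 * 0 ^ n"
      by (rule circle_mean_interior) (intro continuous_intros holomorphic_intros contvp holvp)+
    moreover have "circle_mean (\<lambda>z. vm z * z ^ n) = (if n = k then l' else 0)"
    proof (rule circle_mean_exterior)
      have "((\<lambda>z. inverse z ^ j) \<longlongrightarrow> (0::complex) ^ j) at_infinity"
        by (intro tendsto_power tendsto_inverse_0)
      from tendsto_mult[OF lim2 this]
      have "((\<lambda>z. vm z * z powi (int k) * inverse z ^ j) \<longlongrightarrow> (if n = k then l' else 0)) at_infinity"
        using j by (cases "j = 0") (auto simp: n_def zero_power split: if_splits)
      moreover have "\<forall>\<^sub>F z in at_infinity. vm z * z powi (int k) * inverse z ^ j = vm z * z ^ n"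
        using eventually_not_equal_at_infinity[of 0]
        by eventually_elim (use j in \<open>auto simp: n_def power_diff divide_inverse power_inverse\<close>)
      ultimately show "((\<lambda>z. vm z * z ^ n) \<longlongrightarrow> (if n = k then l' else 0)) at_infinity"
        by (rule Lim_transform_eventually)
    qed (intro continuous_intros holomorphic_intros contvm holvm)+
    moreover have "circle_mean (\<lambda>z. vp z * z ^ n) =
        circle_mean (\<lambda>z. (\<Sum>i\<le>k. P i * (z powi (int i - int j) * weight t z)) + vm z * z ^ n)"
    proof (rule circle_mean_cong)
      fix z :: complex assume z: "norm z = 1"
      then have "z \<noteq> 0" by auto
      then have "z ^ i * (z powi (- int k) * z ^ n) = z powi (int i - int j)" for i
        by (simp add: jk power_int_diff power_int_add power_int_minus field_simps)
      note pow = this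
      have "vp z * z ^ n = (\<Sum>i\<le>k. P i * z ^ i) * (z powi (- int k) * weight t z) * z ^ n + vm z * z ^ n"
        using jump1[OF z] jump2[OF z] P(3)[OF z] by (simp only: distrib_right)
      also have "(\<Sum>i\<le>k. P i * z ^ i) * (z powi (- int k) * weight t z) * z ^ n =
          (\<Sum>i\<le>k. P i * (z powi (int i - int j) * weight t z))"
        unfolding sum_distrib_right pow[symmetric] by (intro sum.cong refl) (simp only: mult_ac)
      finally show "vp z * z ^ n = (\<Sum>i\<le>k. P i * (z powi (int i - int j) * weight t z)) + vm z * z ^ n" .
    qed
    moreover have "circle_mean (\<lambda>z. (\<Sum>i\<le>k. P i * (z powi (int i - int j) * weight t z)) + vm z * z ^ n) =
        (\<Sum>i\<le>k. P i * moment t (int i - int j)) + circle_mean (\<lambda>z. vm z * z ^ n)"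
    proof -
      have "continuous_on (sphere 0 1) (\<lambda>z. P i * (z powi (int i - int j) * weight t z))" for i
        by (intro continuous_intros) auto
      then show ?thesis
        unfolding moment_def using contm
        by (simp only: circle_mean_add circle_mean_sum continuous_on_sum finite_atMost circle_mean_mult_left)
    qed
    ultimately have "(\<Sum>i\<le>k. P i * moment t (int i - int j)) = vp 0 * 0 ^ n - (if n = k then l' else 0)"
      by (simp only: eq_diff_eq)
    moreover have "vp 0 * 0 ^ n = (if j = k then vp 0 else 0)" "n = k \<longleftrightarrow> j = 0"
      using j by (auto simp: n_def)
    ultimately show "(\<Sum>i\<le>k. P i * moment t (int i - int j)) =
       (if j = k then vp 0 else 0) - (if j = 0 then l' else 0)"
      by (simp only:)
  qed
qed

section \<open>Algebra of the two coefficient families\<close>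

text \<open>\<open>P k\<close> and \<open>Q k\<close> are the coefficient sequences of the polynomials \<open>Y\<^sub>1\<^sub>1(\<cdot>; k)\<close> and \<open>Y\<^sub>2\<^sub>1(\<cdot>; k)\<close>.\<close>

locale toeplitz_biorthogonal =
  fixes c :: "int \<Rightarrow> complex" and t :: complex
    and P Q :: "nat \<Rightarrow> nat \<Rightarrow> complex" and a b d :: "nat \<Rightarrow> complex"
  assumes sym: "c (- m) = c m"
    and rec: "of_int m * c m = t * (c (m - 1) - c (m + 1))"
    and P_lead: "P k k = 1" and P_0: "P k 0 = - b k"
    and Q_lead: "Q k k = 0" and Q_0: "Q k 0 = - a k"
    and P_orth: "j \<le> k \<Longrightarrow> (\<Sum>i\<le>k. P k i * c (int i - int j)) = (if j = k then d k else 0)"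
    and Q_orth: "j \<le> k \<Longrightarrow> (\<Sum>i\<le>k. Q k i * c (int i - int j)) =
      (if j = k then - b k else 0) - (if j = 0 then 1 else 0)"
begin

text \<open>Swapping the sums moves the symmetric moment matrix onto \<open>Q k\<close>, and
  \<open>Q_orth\<close> keeps only the two end coefficients of \<open>R\<close>.\<close>

lemma Q_pairing:
  assumes "k \<ge> 1"
  shows "(\<Sum>i\<le>k. Q k i * (\<Sum>j\<le>k. R j * c (int j - int i))) = - R 0 - b k * R k"
proof -
  have "(\<Sum>i\<le>k. Q k i * (\<Sum>j\<le>k. R j * c (int j - int i))) =
      (\<Sum>j\<le>k. R j * (\<Sum>i\<le>k. Q k i * c (int i - int j)))"
    unfolding sum_distrib_left
    by (subst sum.swap, intro sum.cong refl)
      (metis (no_types, lifting) minus_diff_eq mult.left_commute sym)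
  also have "\<dots> = (\<Sum>j\<le>k. (if j = k then - b k * R k else 0) + (if j = 0 then - R 0 else 0))"
    using assms by (intro sum.cong refl) (auto simp: Q_orth)
  also have "\<dots> = - R 0 - b k * R k"
    by (simp add: sum.distrib)
  finally show ?thesis .
qed

text \<open>The form for test polynomials with a single surviving moment; index k drops out because
  \<open>Q k k = 0\<close>.\<close>

lemma Q_pairing_single:
  assumes "k \<ge> 1" "m < k"
    and "\<And>i. i < k \<Longrightarrow> i \<noteq> m \<Longrightarrow> (\<Sum>j\<le>k. R j * c (int j - int i)) = 0"
  shows "Q k m * (\<Sum>j\<le>k. R j * c (int j - int m)) = - R 0 - b k * R k"
proof -
  have "(\<Sum>i\<le>k. Q k i * (\<Sum>j\<le>k. R j * c (int j - int i))) =
      (\<Sum>i\<in>{m}. Q k i * (\<Sum>j\<le>k. R j * c (int j - int i)))"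
  proof (rule sum.mono_neutral_right)
    show "\<forall>i\<in>{..k} - {m}. Q k i * (\<Sum>j\<le>k. R j * c (int j - int i)) = 0"
      using assms(3) Q_lead by (auto simp: le_less)
  qed (use assms in auto)
  then show ?thesis using Q_pairing[OF assms(1), of R] by simp
qed

text \<open>Reversing the coefficients reflects the moment index, so the reversed polynomial is
  orthogonal to z^i for 0 < i <= k.\<close>

lemma sum_reversed_P:
  "(\<Sum>j\<le>k. P k (k - j) * c (int j - int i)) = (\<Sum>j\<le>k. P k j * c (int j - (int k - int i)))"
proof -
  have "(\<Sum>j\<le>k. P k (k - j) * c (int j - int i)) = (\<Sum>j\<le>k. P k (k - (k - j)) * c (int (k - j) - int i))"
    by (rule sum.reindex_bij_witness[of _ "\<lambda>j. k - j" "\<lambda>j. k - j"]) auto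
  also have "\<dots> = (\<Sum>j\<le>k. P k j * c (int j - (int k - int i)))"
  proof (intro sum.cong refl)
    fix j assume "j \<in> {..k}"
    then have "int (k - j) - int i = - (int j - (int k - int i))" "k - (k - j) = j" by auto
    then show "P k (k - (k - j)) * c (int (k - j) - int i) = P k j * c (int j - (int k - int i))"
      by (simp only: sym)
  qed
  finally show ?thesis .
qed

text \<open>The test polynomial is the reversed pi_k, padded to degree k+1. In particular
  \<open>d k\<close> is nonzero, which later allows cancellation.\<close>

lemma a_mult_d: "a (Suc k) * d k = 1"
proof -
  define R where "R j = (if j \<le> k then P k (k - j) else 0)" for j
  have mom: "(\<Sum>j\<le>Suc k. R j * c (int j - int i)) = (if i = 0 then d k else 0)" if "i \<le> k" for i
    using P_orth[of "k - i" k] that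
    by (simp add: R_def sum_reversed_P of_nat_diff split: if_splits)
  have "Q (Suc k) 0 * d k = - 1"
    using Q_pairing_single[of "Suc k" 0 R] mom[of 0] mom P_lead by (simp add: R_def)
  then show ?thesis by (simp add: Q_0)
qed

text \<open>The test polynomial is pi_k, padded to degree k+1; only the moment at i = k
  survives.\<close>

lemma Q_sublead: "Q (Suc k) k = a (Suc k) * b k"
proof -
  define R where "R j = (if j \<le> k then P k j else 0)" for j
  have mom: "(\<Sum>j\<le>Suc k. R j * c (int j - int i)) = (if i = k then d k else 0)" if "i \<le> k" for i
    using P_orth[OF that] by (simp add: R_def)
  have "Q (Suc k) k * d k = b k"
    using Q_pairing_single[of "Suc k" k R] mom P_0 by (simp add: R_def)
  then show ?thesis using a_mult_d[of k]
    by (metis mult.assoc mult.commute mult_1)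
qed

text \<open>The moment at index -1, just outside the range of \<open>P_orth\<close>. It comes from
  testing with z pi_k, whose only surviving moment is the one at i = 0.\<close>

lemma P_shifted_moment: "(\<Sum>j\<le>k. P k j * c (int j + 1)) = b (Suc k) * d k"
proof -
  define R where "R j = (if j = 0 then 0 else P k (j - 1))" for j
  have mom: "(\<Sum>j\<le>Suc k. R j * c (int j - int i)) = (\<Sum>j\<le>k. P k j * c (int j + 1 - int i))" for i
    by (subst sum.atMost_Suc_shift) (simp add: R_def add.commute)
  have "(\<Sum>j\<le>Suc k. R j * c (int j - int i)) = 0" if "i < Suc k" "i \<noteq> 0" for i
    using P_orth[of "i - 1" k] that unfolding mom by (simp add: of_nat_diff algebra_simps)
  from Q_pairing_single[of "Suc k" 0 R, OF _ _ this]
  have "a (Suc k) * (\<Sum>j\<le>k. P k j * c (int j + 1)) = b (Suc k)"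
    unfolding mom using P_lead by (simp add: R_def Q_0)
  then show ?thesis using a_mult_d[of k]
    by (metis mult.assoc mult.commute mult_1)
qed

text \<open>The reversed pi_k again, now at its own degree, so its top coefficient - b(k)
  contributes the square.\<close>

lemma a_mult_d_same:
  assumes "k \<ge> 1"
  shows "a k * d k = 1 - (b k)\<^sup>2"
proof -
  have mom: "(\<Sum>j\<le>k. P k (k - j) * c (int j - int i)) = (if i = 0 then d k else 0)" if "i \<le> k" for i
    using P_orth[of "k - i" k] that
    by (simp add: sum_reversed_P of_nat_diff split: if_splits)
  have "Q k 0 * d k = - 1 + (b k)\<^sup>2"
    using Q_pairing_single[of k 0 "\<lambda>j. P k (k - j)"] mom[of 0] mom P_lead P_0 assms
    by (simp add: power2_eq_square)
  then show ?thesis by (simp add: Q_0 algebra_simps)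
qed

text \<open>
  The pairing is applied to \<open>z \<pi>\<^sub>n'(z) - n \<pi>\<^sub>n(z)\<close> with \<open>n = Suc k\<close>: the recurrence of the moments
  (integration by parts) makes it orthogonal to all \<open>z\<^sup>j\<close> with \<open>0 < j < k\<close>.
\<close>

lemma painleve:
  "of_nat (Suc k) * b (Suc k) +
     t * (b k + b (Suc (Suc k))) * (1 - (b (Suc k))\<^sup>2) = 0"
proof -
  define n where "n = Suc k"
  \<comment> \<open>Subtracting n makes the top coefficient vanish, so the pairing equals - R(0) = -
    n b(n).\<close>
  define R where "R j = (of_nat j - of_nat n) * P n j" for j
  define M where "M i = (\<Sum>j\<le>n. P n j * c (int j - i))" for i
  have M: "M (int i) = (if i = n then d n else 0)" if "i \<le> n" for i
    using P_orth[OF that] by (simp add: M_def)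
  have M_neg: "M (- 1) = b (Suc n) * d n"
    using P_shifted_moment[of n] by (simp add: M_def)
  have mom: "(\<Sum>j\<le>n. R j * c (int j - int i)) =
      t * ((if i = k then d n else 0) - (if i = 0 then b (Suc n) * d n else 0))" if "i \<le> k" for i
  proof -
    \<comment> \<open>The factor j - n splits as (i - n) + (j - i): the first part multiplies a
      vanishing moment, and the recurrence trades the second for neighbouring moments.\<close>
    have "R j * c (int j - int i) = (of_nat i - of_nat n) * (P n j * c (int j - int i)) +
        t * (P n j * c (int j - (int i + 1)) - P n j * c (int j - (int i - 1)))" for j
    proof -
      have "R j * c (int j - int i) = (of_nat i - of_nat n) * (P n j * c (int j - int i)) +
          P n j * (of_int (int j - int i) * c (int j - int i))"
        by (simp add: R_def algebra_simps)
      also have "of_int (int j - int i) * c (int j - int i) =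
          t * (c (int j - (int i + 1)) - c (int j - (int i - 1)))"
        by (subst rec) (simp add: algebra_simps)
      finally show ?thesis by (simp add: algebra_simps)
    qed
    then have "(\<Sum>j\<le>n. R j * c (int j - int i)) =
        (of_nat i - of_nat n) * M (int i) + t * (M (int i + 1) - M (int i - 1))"
      by (simp add: M_def sum.distrib sum_subtractf flip: sum_distrib_left)
    moreover have "M (int i) = 0" using that M[of i] by (simp add: n_def)
    moreover have "M (int i + 1) = (if i = k then d n else 0)"
      using that M[of "Suc i"] by (simp add: n_def add.commute)
    moreover have "M (int i - 1) = (if i = 0 then b (Suc n) * d n else 0)"
      using that M[of "i - 1"] M_neg by (cases i) (auto simp: n_def)
    ultimately show ?thesis by simp
  qed
  have "(\<Sum>i\<le>n. Q n i * (\<Sum>j\<le>n. R j * c (int j - int i))) =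
      (\<Sum>i\<le>k. Q n i * (t * ((if i = k then d n else 0) - (if i = 0 then b (Suc n) * d n else 0))))"
    using Q_lead[of n] mom by (simp add: n_def)
  \<comment> \<open>Keeping the two indicators apart also covers k = 0, where both fall on i =
    0.\<close>
  also have "\<dots> = (\<Sum>i\<le>k. (if i = k then Q n k * t * d n else 0) - (if i = 0 then Q n 0 * t * b (Suc n) * d n else 0))"
    by (intro sum.cong refl) (auto simp: algebra_simps)
  also have "\<dots> = Q n k * t * d n - Q n 0 * t * b (Suc n) * d n"
    by (simp add: sum_subtractf)
  also have "\<dots> = t * (b k + b (Suc n)) * (a n * d n)"
    by (simp add: n_def Q_sublead Q_0 algebra_simps)
  finally have "t * (b k + b (Suc n)) * (a n * d n) = - R 0 - b n * R n"
    using Q_pairing[of n R] by (simp add: n_def)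
  moreover have "a n * d n = 1 - (b n)\<^sup>2"
    by (rule a_mult_d_same) (simp add: n_def)
  ultimately have "t * (b k + b (Suc n)) * (1 - (b n)\<^sup>2) = - (of_nat n * b n)"
    using P_0[of n] by (simp add: R_def)
  then show ?thesis
    unfolding n_def by (simp only: right_minus)
qed

end

section \<open>From the Riemann-Hilbert problem to the recurrences\<close>

text \<open>The jump acts from the right, so each row is a scalar problem of its own; the rows
  differ only in their normalisation, a row of the identity matrix.\<close>

lemma solves_RHP_row_moments:
  fixes Y :: "complex \<Rightarrow> complex^2^2" and i :: 2
  assumes "solves_RHP t k Y"
  obtains P where "P k = (mat 1 :: complex^2^2) $ i $ 1" "P 0 = Y 0 $ i $ 1"
    "\<And>j. j \<le> k \<Longrightarrow> (\<Sum>n\<le>k. P n * moment t (int n - int j)) =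
       (if j = k then Y 0 $ i $ 2 else 0) - (if j = 0 then (mat 1 :: complex^2^2) $ i $ 2 else 0)"
proof -
  note result = that
  obtain Yp Ym E :: "complex \<Rightarrow> complex^2^2" where
    holp [rule_format]: "\<forall>i j. (\<lambda>z. Y z $ i $ j) holomorphic_on {z. norm z < 1}" and
    holm [rule_format]: "\<forall>i j. (\<lambda>z. Y z $ i $ j) holomorphic_on {z. norm z > 1}" and
    contp: "continuous_on {z. norm z \<le> 1} Yp" and Yp [rule_format]: "\<forall>z. norm z < 1 \<longrightarrow> Yp z = Y z" and
    contm: "continuous_on {z. norm z \<ge> 1} Ym" and Ym [rule_format]: "\<forall>z. norm z > 1 \<longrightarrow> Ym z = Y z" and
    jump [rule_format]: "\<forall>z. norm z = 1 \<longrightarrow> Yp z = Ym z ** jump t k z" and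
    E [rule_format]: "\<forall>i j. (\<lambda>z. E z $ i $ j) \<in> O[at_infinity](\<lambda>z. inverse z)" and
    Y_E: "\<forall>\<^sub>F z in at_infinity. Y z = (mat 1 + E z) ** mat2 (z ^ k) 0 0 (z powi (- int k))"
    using assms unfolding solves_RHP_def by (elim conjE exE) (rule that)
  have ball: "ball 0 1 = {z::complex. norm z < 1}" "cball 0 1 = {z::complex. norm z \<le> 1}"
    by auto
  have contp_entry: "continuous_on (cball 0 1) (\<lambda>z. Yp z $ i $ j)" for j
    unfolding ball by (intro continuous_intros contp)
  have contm_entry: "continuous_on {z. norm z \<ge> 1} (\<lambda>z. Ym z $ i $ j)" for j
    by (intro continuous_intros contm)
  have holp_entry: "(\<lambda>z. Yp z $ i $ j) holomorphic_on ball 0 1" for j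
    unfolding ball by (rule holomorphic_transform[OF holp[of i j]]) (simp add: Yp)
  have holm_entry: "(\<lambda>z. Ym z $ i $ j) holomorphic_on {z. norm z > 1}" for j
    by (rule holomorphic_transform[OF holm[of i j]]) (simp add: Ym)
  have "(inverse :: complex \<Rightarrow> complex) \<in> o[at_infinity](\<lambda>_. 1)"
    by (rule smalloI_tendsto) (simp_all add: tendsto_inverse_0)
  then have "(\<lambda>z. E z $ i $ j) \<in> o[at_infinity](\<lambda>_. 1)" for j
    using E[of i j] landau_o.big_small_trans by blast
  from tendsto_add[OF tendsto_const smalloD_tendsto[OF this]]
  have lim: "((\<lambda>z. (mat 1 :: complex^2^2) $ i $ j + E z $ i $ j) \<longlongrightarrow> (mat 1 :: complex^2^2) $ i $ j) at_infinity" for j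
    by simp
  have ev: "\<forall>\<^sub>F z in at_infinity.
      Ym z $ i $ 1 = ((mat 1 :: complex^2^2) $ i $ 1 + E z $ i $ 1) * z ^ k \<and>
      Ym z $ i $ 2 = ((mat 1 :: complex^2^2) $ i $ 2 + E z $ i $ 2) * z powi (- int k) \<and> z \<noteq> 0"
  proof -
    have "\<forall>\<^sub>F z in at_infinity. norm (z::complex) > 1"
      unfolding eventually_at_infinity by (rule exI[of _ 2]) auto
    with Y_E show ?thesis
      by eventually_elim (auto simp: Ym matrix_matrix_mult_def sum_2)
  qed
  show thesis
  proof (rule jump_row_moments[of "\<lambda>z. Yp z $ i $ 1" "\<lambda>z. Ym z $ i $ 1" "\<lambda>z. Yp z $ i $ 2" "\<lambda>z. Ym z $ i $ 2"
        k t "(mat 1 :: complex^2^2) $ i $ 1" "(mat 1 :: complex^2^2) $ i $ 2"])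
    show "Yp z $ i $ 1 = Ym z $ i $ 1" if "norm z = 1" for z
      using jump[OF that] by (simp add: jump_def matrix_matrix_mult_def sum_2)
    show "Yp z $ i $ 2 = Ym z $ i $ 1 * (z powi (- int k) * weight t z) + Ym z $ i $ 2" if "norm z = 1" for z
      using jump[OF that] by (simp add: jump_def weight_def matrix_matrix_mult_def sum_2)
    show "((\<lambda>z. Ym z $ i $ 1 * z powi (- int k)) \<longlongrightarrow> (mat 1 :: complex^2^2) $ i $ 1) at_infinity"
      by (rule Lim_transform_eventually[OF lim])
        (use ev in eventually_elim, auto simp: power_int_minus)
    show "((\<lambda>z. Ym z $ i $ 2 * z powi (int k)) \<longlongrightarrow> (mat 1 :: complex^2^2) $ i $ 2) at_infinity"
      by (rule Lim_transform_eventually[OF lim])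
        (use ev in eventually_elim, auto simp: power_int_minus)
    show thesis if "P k = (mat 1 :: complex^2^2) $ i $ 1" "P 0 = Yp 0 $ i $ 1"
      "\<And>j. j \<le> k \<Longrightarrow> (\<Sum>n\<le>k. P n * moment t (int n - int j)) =
         (if j = k then Yp 0 $ i $ 2 else 0) - (if j = 0 then (mat 1 :: complex^2^2) $ i $ 2 else 0)" for P
      by (rule result[of P]) (use that Yp[of 0] in simp_all)
  qed (fact contp_entry contm_entry holp_entry holm_entry)+
qed

theorem theorem5p1:
  fixes t :: real
    and Y :: "nat \<Rightarrow> complex \<Rightarrow> complex^2^2"
    and a b d :: "nat \<Rightarrow> complex"
  assumes "t > 0"
    and "\<And>k. solves_RHP t k (Y k)"
    and "\<And>k. Y k 0 = mat2 (- b k) (d k) (- a k) (- b k)"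
  shows "\<forall>k\<ge>1.
      of_nat k / of_real t * b k + (b (k - 1) + b (k + 1)) * (1 - (b k)\<^sup>2) = 0 \<and>
      a k = (1 - (b k)\<^sup>2) * a (k + 1) \<and>
      d k = (1 - (b k)\<^sup>2) * d (k - 1)"
proof -
  have mat_entries: "(mat 1 :: complex^2^2) $ 1 $ 1 = 1" "(mat 1 :: complex^2^2) $ 1 $ 2 = 0"
    "(mat 1 :: complex^2^2) $ 2 $ 1 = 0" "(mat 1 :: complex^2^2) $ 2 $ 2 = 1"
    by (simp_all add: mat_def)
  have "\<exists>P. P k = 1 \<and> P 0 = - b k \<and> (\<forall>j\<le>k. (\<Sum>n\<le>k. P n * moment t (int n - int j)) =
      (if j = k then d k else 0))" for k
    by (rule solves_RHP_row_moments[OF assms(2)[of k], of 1, unfolded mat_entries assms(3) vector_2 if_cancel diff_zero]) blast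
  then obtain P where P: "\<And>k. P k k = 1 \<and> P k 0 = - b k \<and>
      (\<forall>j\<le>k. (\<Sum>n\<le>k. P k n * moment t (int n - int j)) = (if j = k then d k else 0))"
    by metis
  have "\<exists>Q. Q k = 0 \<and> Q 0 = - a k \<and> (\<forall>j\<le>k. (\<Sum>n\<le>k. Q n * moment t (int n - int j)) =
      (if j = k then - b k else 0) - (if j = 0 then 1 else 0))" for k
    by (rule solves_RHP_row_moments[OF assms(2)[of k], of 2, unfolded mat_entries assms(3) vector_2 if_cancel diff_zero]) blast
  then obtain Q where Q: "\<And>k. Q k k = 0 \<and> Q k 0 = - a k \<and>
      (\<forall>j\<le>k. (\<Sum>n\<le>k. Q k n * moment t (int n - int j)) =
        (if j = k then - b k else 0) - (if j = 0 then 1 else 0))"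
    by metis
  \<comment> \<open>The equal diagonal entries of \<open>Y k 0\<close> put the same \<open>b\<close>
    into the constant term of \<open>P k\<close> and into the moment conditions on
    \<open>Q k\<close>.\<close>
  interpret toeplitz_biorthogonal "moment t" "of_real t" P Q a b d
    by unfold_locales (use P Q in \<open>blast intro: moment_minus moment_recurrence\<close>)+
  show ?thesis
  proof (intro allI impI)
    fix k :: nat assume "k \<ge> 1"
    then obtain n where k: "k = Suc n"
      by (cases k) auto
    have "of_nat k / of_real t * b k + (b (k - 1) + b (k + 1)) * (1 - (b k)\<^sup>2) =
        (of_nat k * b k + of_real t * (b n + b (Suc k)) * (1 - (b k)\<^sup>2)) / of_real t"
      using \<open>t > 0\<close> by (simp add: k add_divide_distrib del: of_nat_Suc)
    also have "\<dots> = 0"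
      using painleve[of n] by (simp only: k div_0)
    finally have "of_nat k / of_real t * b k + (b (k - 1) + b (k + 1)) * (1 - (b k)\<^sup>2) = 0" .
    \<comment> \<open>Multiply a(k) d(k) = 1 - b(k)^2 by a(k+1), using a(k+1) d(k) = 1; the relation
      for d is obtained in the same way from a(k) d(k-1) = 1.\<close>
    moreover have "a k = (1 - (b k)\<^sup>2) * a (k + 1)"
      using a_mult_d_same[OF \<open>k \<ge> 1\<close>] a_mult_d[of k]
      by (metis Suc_eq_plus1 mult.assoc mult.commute mult_1)
    moreover have "d k = (1 - (b k)\<^sup>2) * d (k - 1)"
      using a_mult_d_same[OF \<open>k \<ge> 1\<close>] a_mult_d[of n]
      by (metis k diff_Suc_1 mult.assoc mult.commute mult_1)
    ultimately show "of_nat k / of_real t * b k + (b (k - 1) + b (k + 1)) * (1 - (b k)\<^sup>2) = 0 \<and>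
      a k = (1 - (b k)\<^sup>2) * a (k + 1) \<and>
      d k = (1 - (b k)\<^sup>2) * d (k - 1)"
      by simp
  qed
qed

end
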